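(* Suppose $C_{w,\varphi}:E\to E$ is $\tau_p$-supercyclic. Then $$\overline{\left\{\frac{\prod_{m=0}^{n-1}w(\varphi^m(z_1))\,f(\varphi^n(z_1))}{\prod_{m=0}^{n-1}w(\varphi^m(z_2))\,f(\varphi^n(z_2))}\ :\ n\in\mathbb{N},\ f(\varphi^n(z_2))\neq 0\right\}}=\mathbb{C}$$ for every $\tau_p$-supercyclic function $f$ of $C_{w,\varphi}$ and all $z_1\neq z_2$ in $X$. If in addition $(\varphi^n(z_1))_n$ and $(\varphi^n(z_2))_n$ are convergent in $X$ to some (fixed) points $a$ and $b$, respectively, then $$\overline{\left\{\frac{\prod_{m=0}^{n}w(\varphi^m(z_1))}{\prod_{m=0}^{n}w(\varphi^m(z_2))}\ :\ n\in\mathbb{N}\right\}}=\mathbb{C}.$$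
   Context: $X$ is a Hausdorff topological space with at least two points; $C(X)$ is the space of continuous functions $X\to\mathbb{C}$; $\tau_p$ is the topology of pointwise convergence on $X$. $E$ is an infinite dimensional locally convex space continuously included in $(C(X),\tau_p)$ such that the evaluations $\delta_x:f\mapsto f(x)$, $x\in X$, are linearly independent in the dual $E'$. The functions $w:X\to\mathbb{C}$ and $\varphi:X\to X$ are continuous, with $w$ zero-free and $\varphi$ injective, and such that $C_{w,\varphi}:E\to E$, $f\mapsto w\cdot(f\circ\varphi)$, is well defined and continuous. $\varphi^n$ is the $n$-th iterate of $\varphi$ ($\varphi^0=\mathrm{id}$). A function $f\in E$ is a $\tau_p$-supercyclic function (vector) of $C_{w,\varphi}$ if $\{\lambda C_{w,\varphi}^n f:\lambda\in\mathbb{C},\ n=0,1,2,\dots\}$ is dense in $E$ for the topology induced by $\tau_p$; $C_{w,\varphi}$ is $\tau_p$-supercyclic if such an $f$ exists. Closures are taken in $\mathbb{C}$. *)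

theory Defs
  imports "HOL-Analysis.Analysis" "HOL-Library.Function_Algebras"
begin

text \<open>
  The library has no type class of complex vector spaces, so the vector space of all functions
  \<open>'a \<Rightarrow> complex\<close> is obtained by interpreting the locale \<^locale>\<open>vector_space\<close>. Addition and zero
  are the pointwise ones of \<^theory>\<open>HOL-Library.Function_Algebras\<close>.
\<close>

definition fun_scale :: "complex \<Rightarrow> ('a \<Rightarrow> complex) \<Rightarrow> 'a \<Rightarrow> complex" where
  "fun_scale c f = (\<lambda>x. c * f x)"

global_interpretation fun_space: vector_space fun_scale
  by unfold_locales (auto simp: fun_scale_def fun_eq_iff algebra_simps)

definition pointwise_topology :: "('a \<Rightarrow> complex) topology" where
  "pointwise_topology = product_topology (\<lambda>_. euclidean) UNIV"

text \<open>
  A space of functions \<open>E\<close> with its own topology is represented by a single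
  \<open>T :: ('a \<Rightarrow> complex) topology\<close> with \<open>E = topspace T\<close>; \<open>T\<close> need not be a subspace topology of
  \<open>pointwise_topology\<close>. The Hausdorff property is not listed below: it follows whenever \<open>T\<close> is
  continuously included in \<open>pointwise_topology\<close>.
\<close>

definition locally_convex_function_space :: "('a \<Rightarrow> complex) topology \<Rightarrow> bool" where
  "locally_convex_function_space T \<longleftrightarrow>
     fun_space.subspace (topspace T) \<and>
     continuous_map (prod_topology T T) T (\<lambda>(f, g). f + g) \<and>
     continuous_map (prod_topology euclidean T) T (\<lambda>(c, f). fun_scale c f) \<and>
     (\<forall>U. openin T U \<and> 0 \<in> U \<longrightarrow>
        (\<exists>V. openin T V \<and> 0 \<in> V \<and> V \<subseteq> U \<and>
           (\<forall>f\<in>V. \<forall>g\<in>V. \<forall>t\<in>{0..1::real}.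
              fun_scale (of_real (1 - t)) f + fun_scale (of_real t) g \<in> V)))"

definition infinite_dimensional :: "('a \<Rightarrow> complex) set \<Rightarrow> bool" where
  "infinite_dimensional E \<longleftrightarrow> \<not> (\<exists>B. finite B \<and> fun_space.span B = E)"

definition continuously_included :: "('a::topological_space \<Rightarrow> complex) topology \<Rightarrow> bool" where
  "continuously_included T \<longleftrightarrow>
     continuous_map T (subtopology pointwise_topology {f. continuous_on UNIV f}) (\<lambda>f. f)"

text \<open>
  A functional on \<open>E\<close> is represented by its extension by zero off \<open>E\<close>, so that equality and linear
  relations between such extensions are exactly those between functionals on \<open>E\<close>.
\<close>

definition evaluation :: "('a \<Rightarrow> complex) set \<Rightarrow> 'a \<Rightarrow> ('a \<Rightarrow> complex) \<Rightarrow> complex" where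
  "evaluation E x = (\<lambda>f. if f \<in> E then f x else 0)"

definition evaluations_independent :: "('a \<Rightarrow> complex) set \<Rightarrow> bool" where
  "evaluations_independent E \<longleftrightarrow>
     inj (evaluation E) \<and> fun_space.independent (range (evaluation E))"

definition weighted_comp ::
    "('a \<Rightarrow> complex) \<Rightarrow> ('a \<Rightarrow> 'a) \<Rightarrow> ('a \<Rightarrow> complex) \<Rightarrow> 'a \<Rightarrow> complex" where
  "weighted_comp w \<phi> f = (\<lambda>x. w x * f (\<phi> x))"

definition pointwise_supercyclic_vector ::
    "('a \<Rightarrow> complex) set \<Rightarrow> (('a \<Rightarrow> complex) \<Rightarrow> 'a \<Rightarrow> complex) \<Rightarrow> ('a \<Rightarrow> complex) \<Rightarrow> bool" where
  "pointwise_supercyclic_vector E C f \<longleftrightarrow>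
     f \<in> E \<and>
     subtopology pointwise_topology E closure_of {fun_scale c ((C ^^ n) f) | c n. True} = E"

definition pointwise_supercyclic ::
    "('a \<Rightarrow> complex) set \<Rightarrow> (('a \<Rightarrow> complex) \<Rightarrow> 'a \<Rightarrow> complex) \<Rightarrow> bool" where
  "pointwise_supercyclic E C \<longleftrightarrow> (\<exists>f. pointwise_supercyclic_vector E C f)"

end

theory Submission
  imports Defs
begin

text \<open>
  Since \<open>\<delta>\<^bsub>z\<^sub>1\<^esub>\<close> and \<open>\<delta>\<^bsub>z\<^sub>2\<^esub>\<close> are linearly independent, \<open>g \<mapsto> (g z\<^sub>1, g z\<^sub>2)\<close> is a pointwise continuous map
  from \<open>E\<close> onto \<open>\<complex>\<^sup>2\<close>, so it sends the projective orbit of a supercyclic \<open>f\<close> to a dense set. The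
  quotient of the two coordinates forgets the scalar, which gives the first claim. For the second,
  the limits \<open>a\<close> and \<open>b\<close> are fixed points of \<open>\<phi>\<close>, and \<open>f\<close> vanishes at neither, as otherwise its whole
  orbit would; hence the factors \<open>f (\<phi>\<^sup>n z\<^sub>1) / f (\<phi>\<^sup>n z\<^sub>2)\<close> converge to a nonzero number and can be
  divided out, because a dense sequence in \<open>\<complex>\<close> stays dense after omitting finitely many terms.
\<close>

lemma closure_eq_UNIV_iff:
  "closure S = UNIV \<longleftrightarrow> (\<forall>U. open U \<and> U \<noteq> {} \<longrightarrow> U \<inter> S \<noteq> {})"
proof
  assume S: "closure S = UNIV"
  show "\<forall>U. open U \<and> U \<noteq> {} \<longrightarrow> U \<inter> S \<noteq> {}"
    using open_Int_closure_eq_empty [of _ S] unfolding S by auto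
next
  assume "\<forall>U. open U \<and> U \<noteq> {} \<longrightarrow> U \<inter> S \<noteq> {}"
  moreover have "- closure S \<inter> S = {}" "open (- closure S)"
    using closure_subset [of S] by auto
  ultimately have "- closure S = {}"
    by blast
  then show "closure S = UNIV"
    by auto
qed

text \<open>In a perfect T1 space a nonempty open set is infinite, so deleting the finitely many
  values \<open>s 0, ..., s (N - 1)\<close> leaves a nonempty open set. Density provides a term in
  it, and its index must be at least \<open>N\<close>.\<close>

lemma dense_sequence_frequently:
  fixes s :: "nat \<Rightarrow> 'b::{perfect_space,t1_space}"
  assumes dense: "closure {s n | n. P n} = UNIV" and U: "open U" "U \<noteq> {}"
  shows "\<exists>\<^sub>F n in sequentially. P n \<and> s n \<in> U"
  unfolding frequently_sequentially
proof
  fix N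
  have fin: "finite (s ` {..<N})"
    by simp
  have "infinite U"
    using U interior_limit_point [of _ U] islimpt_finite [of U] by (auto simp: interior_open)
  then have "U - s ` {..<N} \<noteq> {}"
    using fin by (metis finite_subset Diff_eq_empty_iff)
  moreover have "open (U - s ` {..<N})"
    using U fin by (simp add: finite_imp_closed open_Diff)
  ultimately have "(U - s ` {..<N}) \<inter> {s n | n. P n} \<noteq> {}"
    using dense unfolding closure_eq_UNIV_iff by blast
  then obtain n where "P n" "s n \<in> U" "s n \<notin> s ` {..<N}"
    by blast
  then show "\<exists>n\<ge>N. P n \<and> s n \<in> U"
    by (metis imageI lessThan_iff not_less)
qed

lemma evaluation_pair_surj:
  assumes sub: "fun_space.subspace E" and indep: "evaluations_independent E"
    and ne: "z\<^sub>1 \<noteq> z\<^sub>2"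
  obtains g where "g \<in> E" "g z\<^sub>1 = u" "g z\<^sub>2 = v"
proof -
  have inj: "evaluation E z\<^sub>1 \<noteq> evaluation E z\<^sub>2"
    using indep ne by (auto simp: evaluations_independent_def dest: injD)
  have "fun_space.independent {evaluation E z\<^sub>1, evaluation E z\<^sub>2}"
    using indep unfolding evaluations_independent_def
    by (elim conjE fun_space.independent_mono) auto
  then have nospan: "evaluation E z\<^sub>1 \<notin> fun_space.span {evaluation E z\<^sub>2}"
    and indep2: "fun_space.independent {evaluation E z\<^sub>2}"
    using inj by (auto simp: fun_space.independent_insert)
  have "evaluation E z\<^sub>2 \<noteq> 0"
    using indep2 fun_space.dependent_zero by fastforce
  then obtain h where h: "h \<in> E" "h z\<^sub>2 \<noteq> 0"
    by (auto simp: evaluation_def fun_eq_iff split: if_splits)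
  \<comment> \<open>The scalar is chosen so that both sides agree at \<open>h\<close>. A function
    \<open>g\<close> at which they differ therefore makes the determinant \<open>d\<close> below
    nonzero.\<close>
  have "evaluation E z\<^sub>1 \<noteq> fun_scale (h z\<^sub>1 / h z\<^sub>2) (evaluation E z\<^sub>2)"
    using nospan by (metis fun_space.span_base fun_space.span_scale singletonI)
  then obtain g where g: "g \<in> E" "g z\<^sub>1 \<noteq> h z\<^sub>1 / h z\<^sub>2 * g z\<^sub>2"
    by (auto simp: evaluation_def fun_scale_def fun_eq_iff split: if_splits)
  define d where "d = g z\<^sub>1 * h z\<^sub>2 - g z\<^sub>2 * h z\<^sub>1"
  have d: "d \<noteq> 0"
    using g h by (auto simp: d_def field_simps)
  \<comment> \<open>Cramer's rule: the coefficients solve the 2 by 2 system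
    \<open>k z\<^sub>1 = u\<close>, \<open>k z\<^sub>2 = v\<close>, whose determinant is
    \<open>d\<close>.\<close>
  define k where "k = fun_scale ((u * h z\<^sub>2 - v * h z\<^sub>1) / d) g + fun_scale ((v * g z\<^sub>1 - u * g z\<^sub>2) / d) h"
  have "k \<in> E"
    unfolding k_def using g h sub by (intro fun_space.subspace_add fun_space.subspace_scale)
  moreover have "k z\<^sub>1 = u" "k z\<^sub>2 = v"
    using d by (simp_all add: k_def fun_scale_def divide_simps) (simp_all add: d_def algebra_simps)
  ultimately show thesis
    by (rule that)
qed

text \<open>The outermost application contributes \<open>w x\<close> and moves the point to
  \<open>\<phi> x\<close>; hence the induction is over all \<open>x\<close> and the product is split
  at \<open>m = 0\<close>.\<close>

lemma funpow_weighted_comp: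
  "(weighted_comp w \<phi> ^^ n) f x = (\<Prod>m<n. w ((\<phi> ^^ m) x)) * f ((\<phi> ^^ n) x)"
  by (induction n arbitrary: x)
    (simp_all add: weighted_comp_def prod.lessThan_Suc_shift funpow_swap1 [of \<phi>] del: prod.lessThan_Suc)

lemma supercyclic_orbit_pair_dense:
  assumes sub: "fun_space.subspace E" and indep: "evaluations_independent E"
    and f: "pointwise_supercyclic_vector E (weighted_comp w \<phi>) f"
    and ne: "z\<^sub>1 \<noteq> z\<^sub>2" and U: "open U" "U \<noteq> {}"
  obtains c n where
    "(c * ((\<Prod>m<n. w ((\<phi> ^^ m) z\<^sub>1)) * f ((\<phi> ^^ n) z\<^sub>1)),
      c * ((\<Prod>m<n. w ((\<phi> ^^ m) z\<^sub>2)) * f ((\<phi> ^^ n) z\<^sub>2))) \<in> U"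
proof -
  obtain u v where uv: "(u, v) \<in> U"
    using U by auto
  obtain g where g: "g \<in> E" "g z\<^sub>1 = u" "g z\<^sub>2 = v"
    using evaluation_pair_surj [OF sub indep ne] .
  let ?V = "(\<lambda>h. (h z\<^sub>1, h z\<^sub>2)) -` U"
  have "g \<in> ?V"
    using g uv by simp
  have "open ?V"
    by (intro open_vimage U continuous_on_Pair continuous_on_product_coordinates)
  \<comment> \<open>The type class topology on functions is the product topology, so openness of
    \<open>?V\<close> is openness for pointwise convergence, the topology in which the orbit is
    dense.\<close>
  then have "openin (subtopology pointwise_topology E) (?V \<inter> E)"
    by (simp add: pointwise_topology_def euclidean_product_topology openin_subtopology_Int)
  from openin_Int_closure_of_eq_empty [OF this, of "{fun_scale c ((weighted_comp w \<phi> ^^ n) f) | c n. True}"]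
  have "(?V \<inter> E) \<inter> {fun_scale c ((weighted_comp w \<phi> ^^ n) f) | c n. True} \<noteq> {}"
    using f g(1) \<open>g \<in> ?V\<close> unfolding pointwise_supercyclic_vector_def
    by (metis IntI empty_iff)
  then obtain c n where "fun_scale c ((weighted_comp w \<phi> ^^ n) f) \<in> ?V"
    by auto
  then show thesis
    using that by (simp add: fun_scale_def funpow_weighted_comp)
qed

lemma supercyclic_ratio_dense:
  assumes sub: "fun_space.subspace E" and indep: "evaluations_independent E"
    and f: "pointwise_supercyclic_vector E (weighted_comp w \<phi>) f" and ne: "z\<^sub>1 \<noteq> z\<^sub>2"
  shows "closure {((\<Prod>m<n. w ((\<phi> ^^ m) z\<^sub>1)) * f ((\<phi> ^^ n) z\<^sub>1)) /
                  ((\<Prod>m<n. w ((\<phi> ^^ m) z\<^sub>2)) * f ((\<phi> ^^ n) z\<^sub>2)) | n. f ((\<phi> ^^ n) z\<^sub>2) \<noteq> 0} = UNIV"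
  unfolding closure_eq_UNIV_iff
proof (intro allI impI, elim conjE)
  fix V :: "complex set"
  assume V: "open V" "V \<noteq> {}"
  \<comment> \<open>Restricting to a nonzero second coordinate keeps division continuous. It also
    forces \<open>c\<close> and \<open>f ((\<phi> ^^ n) z\<^sub>2)\<close> to be nonzero for the
    orbit pair found in \<open>U\<close>, so that \<open>c\<close> cancels in the quotient.\<close>
  define U :: "(complex \<times> complex) set" where
    "U = (UNIV \<times> (- {0})) \<inter> (\<lambda>p. fst p / snd p) -` V"
  have "continuous_on (UNIV \<times> (- {0 :: complex})) (\<lambda>p. fst p / snd p)"
    by (auto intro!: continuous_intros)
  then have "open U"
    unfolding U_def using V by (intro continuous_open_preimage) (auto intro: open_Times)
  moreover obtain v where "v \<in> V"
    using V by auto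
  then have "(v, 1) \<in> U"
    by (simp add: U_def)
  then have "U \<noteq> {}"
    by auto
  ultimately obtain c n where
    "(c * ((\<Prod>m<n. w ((\<phi> ^^ m) z\<^sub>1)) * f ((\<phi> ^^ n) z\<^sub>1)),
      c * ((\<Prod>m<n. w ((\<phi> ^^ m) z\<^sub>2)) * f ((\<phi> ^^ n) z\<^sub>2))) \<in> U"
    using supercyclic_orbit_pair_dense [OF sub indep f ne] by metis
  then show "V \<inter> {((\<Prod>m<n. w ((\<phi> ^^ m) z\<^sub>1)) * f ((\<phi> ^^ n) z\<^sub>1)) /
      ((\<Prod>m<n. w ((\<phi> ^^ m) z\<^sub>2)) * f ((\<phi> ^^ n) z\<^sub>2)) | n. f ((\<phi> ^^ n) z\<^sub>2) \<noteq> 0} \<noteq> {}"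
    unfolding U_def by auto
qed

text \<open>If \<open>f a = 0\<close>, all scaled iterates vanish at \<open>a\<close> and miss the
  open set of pairs with nonzero first coordinate. The point \<open>a'\<close> only supplies the
  second coordinate.\<close>

lemma supercyclic_nonzero_at_fixed_point:
  assumes sub: "fun_space.subspace E" and indep: "evaluations_independent E"
    and f: "pointwise_supercyclic_vector E (weighted_comp w \<phi>) f"
    and ne: "a \<noteq> a'" and fixed: "\<phi> a = a"
  shows "f a \<noteq> 0"
proof -
  have "open ((- {0 :: complex}) \<times> (UNIV :: complex set))"
    by (intro open_Times) auto
  moreover have "(- {0 :: complex}) \<times> (UNIV :: complex set) \<noteq> {}"
    by (auto intro!: exI [of _ 1])
  ultimately obtain c n where
    "(c * ((\<Prod>m<n. w ((\<phi> ^^ m) a)) * f ((\<phi> ^^ n) a)),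
      c * ((\<Prod>m<n. w ((\<phi> ^^ m) a')) * f ((\<phi> ^^ n) a'))) \<in> (- {0}) \<times> UNIV"
    using supercyclic_orbit_pair_dense [OF sub indep f ne] by metis
  moreover have "(\<phi> ^^ n) a = a"
    using fixed by (induction n) auto
  ultimately show ?thesis
    by auto
qed

lemma funpow_limit_fixed:
  fixes \<phi> :: "'a::t2_space \<Rightarrow> 'a"
  assumes "continuous_on UNIV \<phi>" and lim: "(\<lambda>n. (\<phi> ^^ n) z) \<longlonglongrightarrow> a"
  shows "\<phi> a = a"
proof -
  have "(\<lambda>n. \<phi> ((\<phi> ^^ n) z)) \<longlonglongrightarrow> \<phi> a"
    using assms by (intro continuous_on_tendsto_compose [OF assms(1) lim]) auto
  moreover have "(\<lambda>n. \<phi> ((\<phi> ^^ n) z)) \<longlonglongrightarrow> a"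
    using LIMSEQ_Suc [OF lim] by simp
  ultimately show ?thesis
    by (rule LIMSEQ_unique)
qed

text \<open>To bring \<open>r n\<close> close to \<open>v\<close>, aim \<open>r n * q n\<close> at
  \<open>v * l\<close>: this succeeds for infinitely many \<open>n\<close>, while \<open>q n\<close>
  is eventually close to \<open>l\<close>, and division is continuous at
  \<open>(v * l, l)\<close>.\<close>

lemma dense_sequence_divide_out:
  fixes r q :: "nat \<Rightarrow> complex"
  assumes dense: "closure {r n * q n | n. P n} = UNIV" and q: "q \<longlonglongrightarrow> l" "l \<noteq> 0"
  shows "closure {r (Suc n) | n. True} = UNIV"
  unfolding closure_eq_UNIV_iff
proof (intro allI impI, elim conjE)
  fix V :: "complex set"
  assume V: "open V" "V \<noteq> {}"
  then obtain v where v: "v \<in> V"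
    by auto
  have "((\<lambda>p. fst p / snd p) \<longlongrightarrow> v * l / l) (nhds (v * l) \<times>\<^sub>F nhds l)"
    by (intro tendsto_divide filterlim_fst filterlim_snd q)
  then have "\<forall>\<^sub>F p in nhds (v * l) \<times>\<^sub>F nhds l. fst p / snd p \<in> V"
    using V v q by (intro topological_tendstoD) auto
  then obtain A B where A: "\<forall>\<^sub>F x in nhds (v * l). A x" and B: "\<forall>\<^sub>F y in nhds l. B y"
    and AB: "\<And>x y. A x \<Longrightarrow> B y \<Longrightarrow> x / y \<in> V"
    by (auto simp: eventually_prod_filter)
  obtain S where S: "open S" "v * l \<in> S" "\<And>x. x \<in> S \<Longrightarrow> A x"
    using A by (auto simp: eventually_nhds)
  \<comment> \<open>Here \<open>q n \<noteq> 0\<close> permits cancelling \<open>q n\<close>, and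
    \<open>n > 0\<close> is needed because the target set omits \<open>r 0\<close>.\<close>
  have "\<forall>\<^sub>F n in sequentially. B (q n) \<and> q n \<noteq> 0 \<and> n > 0"
    using q(1) B tendsto_imp_eventually_ne [OF q] eventually_gt_at_top [of 0]
    by (auto simp: filterlim_iff eventually_conj_iff)
  moreover have "\<exists>\<^sub>F n in sequentially. P n \<and> r n * q n \<in> S"
    using dense_sequence_frequently [OF dense] S by auto
  ultimately obtain n where n: "r n * q n \<in> S" "B (q n)" "q n \<noteq> 0" "n > 0"
    using frequently_ex [OF frequently_eventually_conj] by blast
  then have "r n \<in> V"
    using AB [of "r n * q n" "q n"] S by simp
  then show "V \<inter> {r (Suc n) | n. True} \<noteq> {}"
    using n(4) by (auto simp: gr0_conv_Suc)
qed

theorem proposition4: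
  fixes T :: "('a::t2_space \<Rightarrow> complex) topology"
    and w :: "'a \<Rightarrow> complex"
    and \<phi> :: "'a \<Rightarrow> 'a"
  assumes two_points: "\<exists>x y :: 'a. x \<noteq> y"
    and lcs: "locally_convex_function_space T"
    and inf_dim: "infinite_dimensional (topspace T)"
    and incl: "continuously_included T"
    and indep: "evaluations_independent (topspace T)"
    and w_cont: "continuous_on UNIV w"
    and w_nz: "\<And>x. w x \<noteq> 0"
    and \<phi>_cont: "continuous_on UNIV \<phi>"
    and \<phi>_inj: "inj \<phi>"
    and C_cont: "continuous_map T T (weighted_comp w \<phi>)"
    and supercyclic: "pointwise_supercyclic (topspace T) (weighted_comp w \<phi>)"
  shows "(\<forall>f z\<^sub>1 z\<^sub>2.
            pointwise_supercyclic_vector (topspace T) (weighted_comp w \<phi>) f \<and> z\<^sub>1 \<noteq> z\<^sub>2 \<longrightarrow>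
            closure {((\<Prod>m<n. w ((\<phi> ^^ m) z\<^sub>1)) * f ((\<phi> ^^ n) z\<^sub>1)) /
                     ((\<Prod>m<n. w ((\<phi> ^^ m) z\<^sub>2)) * f ((\<phi> ^^ n) z\<^sub>2)) | n :: nat.
                     f ((\<phi> ^^ n) z\<^sub>2) \<noteq> 0} = UNIV) \<and>
         (\<forall>z\<^sub>1 z\<^sub>2 a b.
            z\<^sub>1 \<noteq> z\<^sub>2 \<and> (\<lambda>n. (\<phi> ^^ n) z\<^sub>1) \<longlonglongrightarrow> a \<and> (\<lambda>n. (\<phi> ^^ n) z\<^sub>2) \<longlonglongrightarrow> b \<longrightarrow>
            closure {(\<Prod>m\<le>n. w ((\<phi> ^^ m) z\<^sub>1)) / (\<Prod>m\<le>n. w ((\<phi> ^^ m) z\<^sub>2)) | n :: nat. True} = UNIV)"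
proof (intro conjI allI impI; elim conjE)
  have sub: "fun_space.subspace (topspace T)"
    using lcs by (simp add: locally_convex_function_space_def)
  {
    fix f and z\<^sub>1 z\<^sub>2 :: 'a
    assume "pointwise_supercyclic_vector (topspace T) (weighted_comp w \<phi>) f" "z\<^sub>1 \<noteq> z\<^sub>2"
    then show "closure {((\<Prod>m<n. w ((\<phi> ^^ m) z\<^sub>1)) * f ((\<phi> ^^ n) z\<^sub>1)) /
                     ((\<Prod>m<n. w ((\<phi> ^^ m) z\<^sub>2)) * f ((\<phi> ^^ n) z\<^sub>2)) | n :: nat.
                     f ((\<phi> ^^ n) z\<^sub>2) \<noteq> 0} = UNIV"
      by (rule supercyclic_ratio_dense [OF sub indep])
  next
    fix z\<^sub>1 z\<^sub>2 a b :: 'a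
    assume ne: "z\<^sub>1 \<noteq> z\<^sub>2" and a: "(\<lambda>n. (\<phi> ^^ n) z\<^sub>1) \<longlonglongrightarrow> a" and b: "(\<lambda>n. (\<phi> ^^ n) z\<^sub>2) \<longlonglongrightarrow> b"
    obtain f where f: "pointwise_supercyclic_vector (topspace T) (weighted_comp w \<phi>) f"
      using supercyclic by (auto simp: pointwise_supercyclic_def)
    \<comment> \<open>Since the space has two points, some point differs from \<open>x\<close> and
      can serve as the auxiliary one.\<close>
    have f_nz: "f x \<noteq> 0" if "\<phi> x = x" for x
      using supercyclic_nonzero_at_fixed_point [OF sub indep f _ that] two_points by metis
    have "f \<in> topspace T"
      using f by (simp add: pointwise_supercyclic_vector_def)
    then have f_cont: "continuous_on UNIV f"
      using incl by (auto simp: continuously_included_def continuous_map_in_subtopology)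
    have f_nz_ab: "f a \<noteq> 0" "f b \<noteq> 0"
      using f_nz funpow_limit_fixed [OF \<phi>_cont] a b by auto
    define q where "q n = f ((\<phi> ^^ n) z\<^sub>1) / f ((\<phi> ^^ n) z\<^sub>2)" for n
    define r where "r n = (\<Prod>m<n. w ((\<phi> ^^ m) z\<^sub>1)) / (\<Prod>m<n. w ((\<phi> ^^ m) z\<^sub>2))" for n
    have "q \<longlonglongrightarrow> f a / f b"
      \<comment> \<open>The quotient converges because \<open>f b \<noteq> 0\<close>; the limit is
        nonzero because \<open>f a \<noteq> 0\<close>.\<close>
      unfolding q_def using f_nz_ab a b
      by (intro tendsto_divide continuous_on_tendsto_compose [OF f_cont]) auto
    moreover have "closure {r n * q n | n. f ((\<phi> ^^ n) z\<^sub>2) \<noteq> 0} = UNIV"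
      using supercyclic_ratio_dense [OF sub indep f ne] by (simp add: r_def q_def)
    ultimately have "closure {r (Suc n) | n. True} = UNIV"
      using f_nz_ab by (intro dense_sequence_divide_out [of r q _ "f a / f b"]) simp_all
    \<comment> \<open>The products now include \<open>m = n\<close>, so they are the terms
      \<open>r (Suc n)\<close>; the empty product \<open>r 0\<close> does not occur.\<close>
    then show "closure {(\<Prod>m\<le>n. w ((\<phi> ^^ m) z\<^sub>1)) / (\<Prod>m\<le>n. w ((\<phi> ^^ m) z\<^sub>2)) | n :: nat. True} = UNIV"
      by (simp only: r_def lessThan_Suc_atMost)
  }
qed

end
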